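(* Let $\mathbf k$ be a field, let $\mathcal H$ be a finite arrangement of linear hyperplanes in $\mathbf k^n$, and let $\mathcal A$ be a subspace arrangement embedded in $\mathcal H$, i.e. an antichain in the intersection lattice $L_{\mathcal H}$. If the blocker ideal equals the vanishing ideal, $\mathcal B_{\mathcal A,\mathcal H}=\mathcal I_{\mathcal A}$, then $\mathcal A$, viewed as an antichain in $L_{\mathcal H}$, has the Turán property.
   Context: The intersection lattice $L_{\mathcal H}$ is the set of all intersections of subfamilies of $\mathcal H$ (the empty intersection being $\mathbf k^n$), ordered by reverse inclusion; its bottom is $\mathbf k^n$, its top is $\bigcap\mathcal H$, and its atoms are the hyperplanes of $\mathcal H$. For $x\in L_{\mathcal H}$, $\Lambda(x)$ is the set of hyperplanes $H\in\mathcal H$ containing $x$, and $\Lambda=\mathcal H$. An antichain in $L_{\mathcal H}$ is a nonempty set of pairwise incomparable elements not containing $\mathbf k^n$. The blocker of an antichain $A$ is $A^*=\min\{x\in L_{\mathcal H}:\Lambda(x)\cap\Lambda(a)\neq\emptyset\ \forall a\in A\}$ ($\min$ = set of minimal elements). For $H\in\mathcal H$, $\ell_H$ is a linear form defining $H$. The vanishing ideal $\mathcal I_{\mathcal A}\subseteq\mathbf k[x_1,\dots,x_n]$ is the ideal of polynomials vanishing identically on every subspace in $\mathcal A$. The blocker ideal is $\mathcal B_{\mathcal A,\mathcal H}=\langle \prod_{H\in\Lambda(B)}\ell_H : B\in\mathcal A^*\rangle$. A set $S\subseteq\Lambda$ of atoms is $\mathcal A$-intersecting if $S\cap\Lambda(a)\neq\emptyset$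 for all $a\in\mathcal A$. An antichain $\mathcal A$ has the Turán property if the smallest cardinality of an $\mathcal A$-intersecting atom set equals $\min\{|\Lambda(b)|: b\in\mathcal A^*\}$. *)

theory Defs
  imports "HOL-Analysis.Analysis" "HOL-Library.Poly_Mapping"
begin

section \<open>Polynomials in variables indexed by a finite type\<close>

text \<open>The polynomial ring over \<^typ>\<open>'k\<close> in the variables $x_i$, $i$ ranging over \<^typ>\<open>'n\<close>:
  finitely supported families of coefficients, indexed by exponent vectors.\<close>

type_synonym ('n, 'k) mpoly = "('n \<Rightarrow>\<^sub>0 nat) \<Rightarrow>\<^sub>0 'k"

definition mvar :: "'n \<Rightarrow> ('n, 'k::field) mpoly"
  where "mvar i = Poly_Mapping.single (Poly_Mapping.single i 1) 1"

definition mconst :: "'k \<Rightarrow> ('n, 'k::field) mpoly"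
  where "mconst c = Poly_Mapping.single 0 c"

definition meval :: "('n::finite, 'k::field) mpoly \<Rightarrow> 'k ^ 'n \<Rightarrow> 'k"
  where "meval p x =
    (\<Sum>m \<in> Poly_Mapping.keys p.
       Poly_Mapping.lookup p m * (\<Prod>i\<in>UNIV. (x $ i) ^ Poly_Mapping.lookup m i))"

definition is_linear_form :: "('n::finite, 'k::field) mpoly \<Rightarrow> bool"
  where "is_linear_form p \<longleftrightarrow> (\<exists>c :: 'n \<Rightarrow> 'k. p = (\<Sum>i\<in>UNIV. mconst (c i) * mvar i))"

lemma module_mult: "module ((*) :: 'a::comm_ring_1 \<Rightarrow> 'a \<Rightarrow> 'a)"
  by standard (simp_all add: algebra_simps)

text \<open>The ideal generated by \<open>G\<close> is the span of \<open>G\<close> in the ring regarded as a module over itself.\<close>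

definition generated_ideal :: "'a::comm_ring_1 set \<Rightarrow> 'a set"
  where "generated_ideal G = module.span (*) G"

section \<open>Hyperplane arrangements and the intersection lattice\<close>

definition linear_hyperplane :: "('k::field ^ 'n) set \<Rightarrow> bool"
  where "linear_hyperplane H \<longleftrightarrow> vec.subspace H \<and> Suc (vec.dim H) = CARD('n)"

definition hyperplane_arrangement :: "('k::field ^ 'n) set set \<Rightarrow> bool"
  where "hyperplane_arrangement \<H> \<longleftrightarrow> finite \<H> \<and> (\<forall>H\<in>\<H>. linear_hyperplane H)"

definition defines_hyperplane :: "('n::finite, 'k::field) mpoly \<Rightarrow> ('k ^ 'n) set \<Rightarrow> bool"
  where "defines_hyperplane p H \<longleftrightarrow> is_linear_form p \<and> H = {x. meval p x = 0}"

text \<open>The empty family contributes the whole space, since \<^prop>\<open>\<Inter>{} = UNIV\<close>.\<close>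

definition intersection_lattice :: "('k ^ 'n) set set \<Rightarrow> ('k ^ 'n) set set"
  where "intersection_lattice \<H> = {\<Inter>F | F. F \<subseteq> \<H>}"

definition lattice_le :: "('k ^ 'n) set \<Rightarrow> ('k ^ 'n) set \<Rightarrow> bool"
  where "lattice_le x y \<longleftrightarrow> y \<subseteq> x"

definition minimal_elements :: "('k ^ 'n) set set \<Rightarrow> ('k ^ 'n) set set"
  where "minimal_elements X = {x \<in> X. \<forall>y\<in>X. lattice_le y x \<longrightarrow> y = x}"

definition atoms_below :: "('k ^ 'n) set set \<Rightarrow> ('k ^ 'n) set \<Rightarrow> ('k ^ 'n) set set"
  where "atoms_below \<H> x = {H \<in> \<H>. lattice_le H x}"

definition lattice_antichain :: "('k ^ 'n) set set \<Rightarrow> ('k ^ 'n) set set \<Rightarrow> bool"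
  where "lattice_antichain \<H> \<A> \<longleftrightarrow>
    \<A> \<subseteq> intersection_lattice \<H> \<and> \<A> \<noteq> {} \<and> UNIV \<notin> \<A> \<and>
    (\<forall>x\<in>\<A>. \<forall>y\<in>\<A>. x \<noteq> y \<longrightarrow> \<not> lattice_le x y)"

definition blocker :: "('k ^ 'n) set set \<Rightarrow> ('k ^ 'n) set set \<Rightarrow> ('k ^ 'n) set set"
  where "blocker \<H> \<A> = minimal_elements
    {x \<in> intersection_lattice \<H>. \<forall>a\<in>\<A>. atoms_below \<H> x \<inter> atoms_below \<H> a \<noteq> {}}"

section \<open>Vanishing ideal and blocker ideal\<close>

definition vanishing_ideal :: "('k::field ^ 'n) set set \<Rightarrow> ('n::finite, 'k) mpoly set"
  where "vanishing_ideal \<A> = {p. \<forall>a\<in>\<A>. \<forall>x\<in>a. meval p x = 0}"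

definition blocker_ideal ::
    "(('k::field ^ 'n) set \<Rightarrow> ('n::finite, 'k) mpoly) \<Rightarrow> ('k ^ 'n) set set \<Rightarrow> ('k ^ 'n) set set
      \<Rightarrow> ('n, 'k) mpoly set"
  where "blocker_ideal \<l> \<H> \<A> =
    generated_ideal ((\<lambda>B. \<Prod>H \<in> atoms_below \<H> B. \<l> H) ` blocker \<H> \<A>)"

section \<open>The Tur\'an property\<close>

definition intersecting_atoms ::
    "('k ^ 'n) set set \<Rightarrow> ('k ^ 'n) set set \<Rightarrow> ('k ^ 'n) set set \<Rightarrow> bool"
  where "intersecting_atoms \<H> \<A> S \<longleftrightarrow>
    S \<subseteq> \<H> \<and> (\<forall>a\<in>\<A>. S \<inter> atoms_below \<H> a \<noteq> {})"

text \<open>For a finite \<open>\<H>\<close> and an antichain \<open>\<A>\<close>, both minima are taken over finite nonempty sets: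
  the set \<open>\<H>\<close> is itself intersecting, and \<open>\<Inter>\<H>\<close> competes in the blocker.\<close>

definition turan_property :: "('k ^ 'n) set set \<Rightarrow> ('k ^ 'n) set set \<Rightarrow> bool"
  where "turan_property \<H> \<A> \<longleftrightarrow>
    Min (card ` {S. intersecting_atoms \<H> \<A> S}) =
    Min ((\<lambda>b. card (atoms_below \<H> b)) ` blocker \<H> \<A>)"

end

theory Submission
  imports Defs "HOL-Computational_Algebra.Polynomial"
begin

text \<open>A smallest intersecting set \<open>S\<close> gives the polynomial \<open>\<Prod>H\<in>S. \<l> H\<close>, which vanishes on every
  member of \<open>\<A>\<close> and hence lies in the blocker ideal. This is a nonzero form of degree \<open>card S\<close>,
  while the blocker ideal is generated by forms of degree at least the blocker minimum \<open>m\<close>; so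
  \<open>m \<le> card S\<close>. Conversely the atoms below any blocker element are intersecting.
  Degrees are measured by the substitution \<open>x\<^sub>i \<mapsto> s t\<^bsup>e i\<^esup>\<close> into \<open>k[t][s]\<close>, with \<open>e\<close> injective:
  it sends a nonzero linear form to \<open>s\<close> times a nonzero element of the integral domain \<open>k[t]\<close>.\<close>

section \<open>Substitution homomorphisms\<close>

definition subst_monomial :: "('n::finite \<Rightarrow> 'a::comm_ring_1) \<Rightarrow> ('n \<Rightarrow>\<^sub>0 nat) \<Rightarrow> 'a"
  where "subst_monomial v m = (\<Prod>i\<in>UNIV. v i ^ Poly_Mapping.lookup m i)"

lemma subst_monomial_zero [simp]: "subst_monomial v 0 = 1"
  by (simp add: subst_monomial_def)

lemma subst_monomial_add:
  "subst_monomial v (m + m') = subst_monomial v m * subst_monomial v m'"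
  by (simp add: subst_monomial_def lookup_add power_add prod.distrib)

lemma subst_monomial_single [simp]:
  "subst_monomial v (Poly_Mapping.single i 1) = v i"
proof -
  have "subst_monomial v (Poly_Mapping.single i 1) = (\<Prod>j\<in>UNIV. if j = i then v j else 1)"
    unfolding subst_monomial_def by (intro prod.cong) (auto simp: lookup_single when_def)
  then show ?thesis by simp
qed

lemma poly_mapping_sum_single:
  "p = (\<Sum>m\<in>Poly_Mapping.keys p. Poly_Mapping.single m (Poly_Mapping.lookup p m))"
  by (rule poly_mapping_eqI)
    (simp add: lookup_sum lookup_single when_def not_in_keys_iff_lookup_eq_zero)

text \<open>Stated for an arbitrary coefficient homomorphism \<open>f\<close> and arbitrary images
  \<open>v\<close> of the variables, so that evaluation at a point and the grading map are two
  instances of one theory.\<close>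

locale polynomial_substitution =
  fixes f :: "'k::field \<Rightarrow> 'a::comm_ring_1"
    and v :: "'n::finite \<Rightarrow> 'a"
  assumes f_zero: "f 0 = 0"
    and f_one: "f 1 = 1"
    and f_add: "f (c + d) = f c + f d"
    and f_mult: "f (c * d) = f c * f d"
begin

definition subst :: "('n, 'k) mpoly \<Rightarrow> 'a"
  where "subst p = (\<Sum>m\<in>Poly_Mapping.keys p. f (Poly_Mapping.lookup p m) * subst_monomial v m)"

text \<open>Cancellation can shrink the support of a sum of polynomials; padding with zero
  coefficients allows several polynomials to be summed over a common index set.\<close>

lemma subst_eq_sum_superset:
  assumes "finite M" "Poly_Mapping.keys p \<subseteq> M"
  shows "subst p = (\<Sum>m\<in>M. f (Poly_Mapping.lookup p m) * subst_monomial v m)"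
  unfolding subst_def
  by (rule sum.mono_neutral_left) (use assms in \<open>auto simp: in_keys_iff f_zero\<close>)

lemma subst_zero: "subst 0 = 0"
  by (simp add: subst_def)

lemma subst_single: "subst (Poly_Mapping.single m c) = f c * subst_monomial v m"
  by (simp add: subst_def f_zero)

lemma subst_one: "subst 1 = 1"
  using subst_single[of 0 1] by (simp add: f_one)

lemma subst_add: "subst (p + q) = subst p + subst q"
proof -
  let ?M = "Poly_Mapping.keys p \<union> Poly_Mapping.keys q"
  have "Poly_Mapping.keys (p + q) \<subseteq> ?M" by (rule Poly_Mapping.keys_add)
  then show ?thesis
    by (simp add: subst_eq_sum_superset[of ?M] lookup_add f_add distrib_right sum.distrib)
qed

lemma subst_sum: "subst (sum g I) = (\<Sum>i\<in>I. subst (g i))"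
  by (induction I rule: infinite_finite_induct) (simp_all add: subst_zero subst_add)

lemma subst_mult: "subst (p * q) = subst p * subst q"
proof -
  have "subst (p * q) = subst
      ((\<Sum>m\<in>Poly_Mapping.keys p. Poly_Mapping.single m (Poly_Mapping.lookup p m)) *
       (\<Sum>m\<in>Poly_Mapping.keys q. Poly_Mapping.single m (Poly_Mapping.lookup q m)))"
    \<comment> \<open>The expansion of \<open>p\<close> into monomials mentions \<open>p\<close>
      again, so it is applied once to each factor; as a rewrite rule it would loop.\<close>
    by (rule arg_cong[where f = subst], rule arg_cong2[where f = "(*)"];
        rule poly_mapping_sum_single)
  also have "\<dots> = (\<Sum>m\<in>Poly_Mapping.keys p. \<Sum>m'\<in>Poly_Mapping.keys q.
      subst (Poly_Mapping.single m (Poly_Mapping.lookup p m) *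
             Poly_Mapping.single m' (Poly_Mapping.lookup q m')))"
    by (simp only: sum_product subst_sum)
  also have "\<dots> = (\<Sum>m\<in>Poly_Mapping.keys p. \<Sum>m'\<in>Poly_Mapping.keys q.
      (f (Poly_Mapping.lookup p m) * subst_monomial v m) *
      (f (Poly_Mapping.lookup q m') * subst_monomial v m'))"
    by (simp add: mult_single subst_single subst_monomial_add f_mult mult_ac)
  also have "\<dots> = subst p * subst q"
    by (simp only: subst_def sum_product)
  finally show ?thesis .
qed

lemma subst_prod: "subst (prod g I) = (\<Prod>i\<in>I. subst (g i))"
  by (induction I rule: infinite_finite_induct) (simp_all add: subst_one subst_mult)

lemma subst_linear_form: "subst (\<Sum>i\<in>UNIV. mconst (c i) * mvar i) = (\<Sum>i\<in>UNIV. f (c i) * v i)"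
  by (simp add: subst_sum subst_mult mconst_def mvar_def subst_single f_one
      flip: One_nat_def)

text \<open>The multiples of \<open>d\<close> form an ideal, and its preimage under the ring
  homomorphism \<open>subst\<close> is again an ideal.\<close>

lemma dvd_subst_of_generated_ideal:
  assumes "p \<in> generated_ideal G" and "\<And>g. g \<in> G \<Longrightarrow> d dvd subst g"
  shows "d dvd subst p"
  using assms(1) unfolding generated_ideal_def
proof (induction rule: module.span_induct_alt[OF module_mult, consumes 1, case_names base step])
  case base
  show ?case by (simp add: subst_zero)
next
  case (step c g p)
  then show ?case by (simp add: subst_add subst_mult assms(2))
qed

end

section \<open>Evaluation at a point, and nonvanishing of defining forms\<close>

interpretation eval: polynomial_substitution "\<lambda>c. c" "vec_nth x" for x :: "'k::field ^ 'n::finite"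
  by unfold_locales simp_all

lemma meval_eq_subst: "meval p x = eval.subst x p"
  by (simp add: meval_def eval.subst_def subst_monomial_def)

lemma is_linear_form_nonzero_coeff:
  assumes "is_linear_form p" "p \<noteq> 0"
  obtains c i where "p = (\<Sum>i\<in>UNIV. mconst (c i) * mvar i)" "c i \<noteq> 0"
proof -
  from assms(1) obtain c where c: "p = (\<Sum>i\<in>UNIV. mconst (c i) * mvar i)"
    unfolding is_linear_form_def by blast
  have "\<exists>i. c i \<noteq> 0"
  proof (rule ccontr)
    assume "\<not> (\<exists>i. c i \<noteq> 0)"
    then have "p = 0" by (simp add: c mconst_def)
    with assms(2) show False by simp
  qed
  with c that show thesis by blast
qed

text \<open>The zero form would cut out the whole space, whose dimension is one too large for a
  hyperplane.\<close>

lemma defines_hyperplane_nonzero: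
  assumes "linear_hyperplane H" "defines_hyperplane p H"
  shows "p \<noteq> 0"
proof
  assume "p = 0"
  with assms(2) have "H = UNIV"
    by (simp add: defines_hyperplane_def meval_def)
  with assms(1) show False
    by (simp add: linear_hyperplane_def card_cart_basis)
qed

section \<open>The grading into \<open>k[t][s]\<close> and the degree bound\<close>

interpretation grade: polynomial_substitution
    "\<lambda>c::'k::field. [:[:c:]:]" "\<lambda>i. monom (monom 1 (e i)) (Suc 0)"
  for e :: "'n::finite \<Rightarrow> nat"
  by unfold_locales (simp_all add: one_pCons)

text \<open>Since \<open>e\<close> is injective, distinct variables go to distinct powers of
  \<open>t\<close>, so their coefficients cannot cancel: that of \<open>g\<close> at
  \<open>e i\<close> is \<open>c i\<close>.\<close>

lemma grade_linear_form:
  fixes p :: "('n::finite, 'k::field) mpoly"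
  assumes "inj e" "is_linear_form p" "p \<noteq> 0"
  obtains g :: "'k poly" where "grade.subst e p = monom g 1" "g \<noteq> 0"
proof -
  from assms(2,3) obtain c i
    where c: "p = (\<Sum>i\<in>UNIV. mconst (c i) * mvar i)" and i: "c i \<noteq> 0"
    by (rule is_linear_form_nonzero_coeff)
  define g where "g = (\<Sum>j\<in>UNIV. monom (c j) (e j))"
  have "coeff g (e i) = (\<Sum>j\<in>UNIV. if j = i then c j else 0)"
    unfolding g_def coeff_sum by (intro sum.cong) (auto simp: injD[OF assms(1)])
  then have "g \<noteq> 0" using i by auto
  moreover have "grade.subst e p = monom g 1"
    by (simp add: c grade.subst_linear_form smult_monom g_def monom_sum)
  ultimately show thesis by (rule that[rotated])
qed

text \<open>Each factor contributes one power of \<open>s\<close>, and the coefficients in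
  \<open>k[t]\<close> multiply to a nonzero element because \<open>k[t]\<close> is a domain.\<close>

lemma grade_prod_linear_forms:
  fixes \<l> :: "'b \<Rightarrow> ('n::finite, 'k::field) mpoly"
  assumes "inj e" "finite S" "\<And>H. H \<in> S \<Longrightarrow> is_linear_form (\<l> H) \<and> \<l> H \<noteq> 0"
  shows "\<exists>g :: 'k poly. g \<noteq> 0 \<and> grade.subst e (\<Prod>H\<in>S. \<l> H) = monom g (card S)"
  using assms(2,3)
proof (induction S rule: finite_induct)
  case empty
  show ?case by (rule exI[of _ 1]) (simp add: grade.subst_one)
next
  case (insert H S)
  then obtain g where g: "g \<noteq> 0" "grade.subst e (\<Prod>H\<in>S. \<l> H) = monom g (card S)"
    by auto
  have H: "is_linear_form (\<l> H)" "\<l> H \<noteq> 0" using insert.prems by auto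
  obtain h where h: "grade.subst e (\<l> H) = monom h 1" "h \<noteq> 0"
    by (rule grade_linear_form[OF assms(1) H])
  have "grade.subst e (\<Prod>H\<in>insert H S. \<l> H) = monom (h * g) (card (insert H S))"
    using insert.hyps by (simp add: grade.subst_mult g(2) h(1) mult_monom)
  with g(1) h(2) show ?case
    by (intro exI[of _ "h * g"]) simp
qed

text \<open>Divisibility by \<open>s^m\<close> says that all coefficients below \<open>m\<close>
  vanish. It passes from the generators to every element of the ideal, while the image of the
  product over \<open>S\<close> has a nonzero coefficient at exactly \<open>card S\<close>.\<close>

lemma prod_linear_forms_degree_bound:
  fixes \<l> :: "'b \<Rightarrow> ('n::finite, 'k::field) mpoly"
  assumes "finite \<H>" "\<And>H. H \<in> \<H> \<Longrightarrow> is_linear_form (\<l> H) \<and> \<l> H \<noteq> 0"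
    and "S \<subseteq> \<H>" "\<And>T. T \<in> \<T> \<Longrightarrow> T \<subseteq> \<H> \<and> m \<le> card T"
    and mem: "(\<Prod>H\<in>S. \<l> H) \<in> generated_ideal ((\<lambda>T. \<Prod>H\<in>T. \<l> H) ` \<T>)"
  shows "m \<le> card S"
proof -
  obtain e :: "'n \<Rightarrow> nat" where e: "inj e"
    using finite_imp_inj_to_nat_seg[OF finite_class.finite_UNIV] by blast
  have grade: "\<exists>g :: 'k poly. g \<noteq> 0 \<and> grade.subst e (\<Prod>H\<in>T. \<l> H) = monom g (card T)"
    if "T \<subseteq> \<H>" for T
    using that assms(1,2) by (intro grade_prod_linear_forms[OF e]) (auto intro: finite_subset)
  have "monom 1 m dvd grade.subst e (\<Prod>H\<in>S. \<l> H)"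
  proof (rule grade.dvd_subst_of_generated_ideal[OF mem])
    fix p assume "p \<in> (\<lambda>T. \<Prod>H\<in>T. \<l> H) ` \<T>"
    then obtain T where T: "T \<in> \<T>" "p = (\<Prod>H\<in>T. \<l> H)" by blast
    with assms(4) grade obtain g where "grade.subst e p = monom g (card T)" by blast
    with assms(4)[OF T(1)] show "monom 1 m dvd grade.subst e p"
      by (simp add: monom_1_dvd_iff')
  qed
  moreover from grade[OF assms(3)] obtain g
    where "g \<noteq> 0" "grade.subst e (\<Prod>H\<in>S. \<l> H) = monom g (card S)" by blast
  ultimately show ?thesis
    by (auto simp: monom_1_dvd_iff' not_less[symmetric])
qed

section \<open>Intersecting sets and the blocker\<close>

lemma atoms_below_nonempty:
  \<comment> \<open>Excluding the whole space rules out the empty subfamily.\<close>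
  assumes "x \<in> intersection_lattice \<H>" "x \<noteq> UNIV"
  shows "atoms_below \<H> x \<noteq> {}"
proof -
  obtain F where F: "F \<subseteq> \<H>" "x = \<Inter>F"
    using assms(1) by (auto simp: intersection_lattice_def)
  with assms(2) obtain H where "H \<in> F" by auto
  with F have "H \<in> atoms_below \<H> x" by (auto simp: atoms_below_def lattice_le_def)
  then show ?thesis by blast
qed

lemma finite_intersection_lattice:
  assumes "finite \<H>"
  shows "finite (intersection_lattice \<H>)"
proof -
  have "intersection_lattice \<H> = Inter ` Pow \<H>"
    by (auto simp: intersection_lattice_def)
  with assms show ?thesis by simp
qed

lemma finite_blocker: "finite \<H> \<Longrightarrow> finite (blocker \<H> \<A>)"
  by (rule finite_subset[OF _ finite_intersection_lattice])
    (auto simp: blocker_def minimal_elements_def)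

text \<open>The lattice order is reverse inclusion, so minimal elements are the inclusion-maximal
  sets.\<close>

lemma minimal_elements_nonempty:
  assumes "finite X" "X \<noteq> {}"
  shows "minimal_elements X \<noteq> {}"
proof -
  obtain x where "x \<in> X" "\<forall>y\<in>X. x \<subseteq> y \<longrightarrow> x = y"
    using finite_has_maximal[OF assms] by blast
  then have "x \<in> minimal_elements X" by (auto simp: minimal_elements_def lattice_le_def)
  then show ?thesis by blast
qed

lemma lattice_antichain_atoms_nonempty:
  assumes "lattice_antichain \<H> \<A>" "a \<in> \<A>"
  shows "atoms_below \<H> a \<noteq> {}"
  using assms by (intro atoms_below_nonempty) (auto simp: lattice_antichain_def)

text \<open>Every hyperplane contains \<open>\<Inter>\<H>\<close>, so its atoms meet those of each
  \<open>a\<close>, which exist as \<open>a\<close> is not the whole space.\<close>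

lemma blocker_nonempty:
  assumes "finite \<H>" "lattice_antichain \<H> \<A>"
  shows "blocker \<H> \<A> \<noteq> {}"
  unfolding blocker_def
proof (rule minimal_elements_nonempty)
  let ?X = "{x \<in> intersection_lattice \<H>. \<forall>a\<in>\<A>. atoms_below \<H> x \<inter> atoms_below \<H> a \<noteq> {}}"
  show "finite ?X" by (simp add: finite_intersection_lattice assms(1))
  have "\<Inter>\<H> \<in> intersection_lattice \<H>" by (auto simp: intersection_lattice_def)
  moreover have "atoms_below \<H> (\<Inter>\<H>) \<inter> atoms_below \<H> a = atoms_below \<H> a" for a
    by (auto simp: atoms_below_def lattice_le_def)
  ultimately have "\<Inter>\<H> \<in> ?X"
    using lattice_antichain_atoms_nonempty[OF assms(2)] by simp
  then show "?X \<noteq> {}" by blast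
qed

lemma blocker_atoms_intersecting:
  "b \<in> blocker \<H> \<A> \<Longrightarrow> intersecting_atoms \<H> \<A> (atoms_below \<H> b)"
  by (auto simp: blocker_def minimal_elements_def intersecting_atoms_def atoms_below_def)

text \<open>A point of \<open>a\<close> lies on some hyperplane of \<open>S\<close> that contains
  \<open>a\<close>, and there the corresponding factor vanishes.\<close>

lemma prod_intersecting_in_vanishing_ideal:
  assumes "finite \<H>" "\<forall>H\<in>\<H>. defines_hyperplane (\<l> H) H" "intersecting_atoms \<H> \<A> S"
  shows "(\<Prod>H\<in>S. \<l> H) \<in> vanishing_ideal \<A>"
  unfolding vanishing_ideal_def
proof (intro CollectI ballI)
  fix a x assume "a \<in> \<A>" "x \<in> a"
  with assms(3) obtain H where "H \<in> S" "H \<in> \<H>" "x \<in> H"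
    by (fastforce simp: intersecting_atoms_def atoms_below_def lattice_le_def)
  with assms(2) have "meval (\<l> H) x = 0" by (auto simp: defines_hyperplane_def)
  moreover have "finite S" using assms(1,3) by (auto simp: intersecting_atoms_def intro: finite_subset)
  ultimately show "meval (\<Prod>H\<in>S. \<l> H) x = 0"
    using \<open>H \<in> S\<close> by (auto simp: meval_eq_subst eval.subst_prod)
qed

theorem theorem5p2:
  fixes \<H> \<A> :: "('k::field ^ 'n::finite) set set"
    and \<l> :: "('k ^ 'n) set \<Rightarrow> ('n, 'k) mpoly"
  assumes arrangement: "hyperplane_arrangement \<H>"
    and forms: "\<forall>H\<in>\<H>. defines_hyperplane (\<l> H) H"
    and embedded: "lattice_antichain \<H> \<A>"
    and ideals_eq: "blocker_ideal \<l> \<H> \<A> = vanishing_ideal \<A>"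
  shows "turan_property \<H> \<A>"
proof -
  have fin: "finite \<H>" using arrangement by (simp add: hyperplane_arrangement_def)
  have linear: "is_linear_form (\<l> H) \<and> \<l> H \<noteq> 0" if "H \<in> \<H>" for H
    using that arrangement forms defines_hyperplane_nonzero[of H "\<l> H"]
    by (simp add: hyperplane_arrangement_def defines_hyperplane_def)
  let ?I = "card ` {S. intersecting_atoms \<H> \<A> S}"
  let ?B = "(\<lambda>b. card (atoms_below \<H> b)) ` blocker \<H> \<A>"
  have finI: "finite ?I"
    by (rule finite_imageI, rule finite_subset[of _ "Pow \<H>"])
      (use fin in \<open>auto simp: intersecting_atoms_def\<close>)
  have finB: "finite ?B" by (simp add: finite_blocker fin)
  have neB: "?B \<noteq> {}" using blocker_nonempty[OF fin embedded] by simp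
  have sub: "?B \<subseteq> ?I" by (auto simp: blocker_atoms_intersecting)
  \<comment> \<open>This is where the equality of the two ideals enters: it moves the product over
    \<open>S\<close> from the vanishing ideal into the blocker ideal.\<close>
  have "Min ?B \<le> card S" if S: "intersecting_atoms \<H> \<A> S" for S
  proof (rule prod_linear_forms_degree_bound[OF fin linear])
    show "S \<subseteq> \<H>" using S by (simp add: intersecting_atoms_def)
    show "T \<subseteq> \<H> \<and> Min ?B \<le> card T" if "T \<in> atoms_below \<H> ` blocker \<H> \<A>" for T
      using that finB by (auto simp: atoms_below_def)
    show "(\<Prod>H\<in>S. \<l> H) \<in>
        generated_ideal ((\<lambda>T. \<Prod>H\<in>T. \<l> H) ` atoms_below \<H> ` blocker \<H> \<A>)"
      using prod_intersecting_in_vanishing_ideal[OF fin forms S]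
      by (simp add: ideals_eq[symmetric] blocker_ideal_def image_image)
  qed
  then have "Min ?B \<le> Min ?I"
    using finI neB sub by (subst Min_ge_iff) auto
  moreover have "Min ?I \<le> Min ?B" by (rule Min_antimono[OF sub neB finI])
  ultimately show ?thesis by (simp add: turan_property_def)
qed

end
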